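(* Let $f(X)\in A[X;\sigma]$ be monic of degree $n$, and let $\mathcal{C}\subseteq A^n$ be the principal $(f,\sigma)$-code generated by a monic $g(X)=\sum_{i=0}^r g_iX^i\in A[X;\sigma]$ of degree $r$ (so $g$ is a right divisor of $f$). Then a generating matrix $G\in M_{n-r,n}(A)$ of $\mathcal{C}$ is $$\left( \begin{array}{cccccccc} g_0 & \cdots & g_r & 0& 0 & \cdots & 0\\ 0 & \sigma(g_0) & \cdots & \sigma(g_r) & 0 &\dots & 0\\ \vdots & \ddots & & &\ddots& & \vdots \\ 0 & 0 & \cdots &0 & \sigma^{n-r-1}(g_0) & \cdots & \sigma^{n-r-1}(g_r) \end{array} \right),$$ i.e. for $0\le i\le n-r-1$, row $i$ consists of $i$ zeros, followed by $\sigma^i(g_0),\dots,\sigma^i(g_r)$, followed by zeros.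
   Context: $A$ is a ring with identity (not necessarily commutative), assumed to have invariant basis number; $\sigma:A\to A$ is a ring endomorphism with $\sigma(1)=1$. $A[X;\sigma]$ is the skew-polynomial ring of elements $\sum a_iX^i$ with multiplication determined by $Xa=\sigma(a)X$; $(p)_l$ is the left ideal generated by $p$. For $f$ monic of degree $n$, let $\phi_f:A^n\to A[X;\sigma]/(f)_l$, $(d_0,\dots,d_{n-1})\mapsto\sum_{i=0}^{n-1} d_iX^i+(f)_l$ (a bijection). An $(f,\sigma)$-code is a set $\phi_f^{-1}(\mathcal{M})$ with $\mathcal{M}$ a left $A[X;\sigma]$-submodule of $A[X;\sigma]/(f)_l$; it is principal, generated by $g$, if $g$ is a right divisor of $f$ and $\mathcal{M}=(g)_l/(f)_l$. A generating matrix of an $A$-free code $\mathcal{C}$ of rank $m$ is a matrix in $M_{m,n}(A)$ whose rows form a basis of $\mathcal{C}$ as a left $A$-module. *)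

theory Defs
  imports
    "HOL-Computational_Algebra.Polynomial"
    "Jordan_Normal_Form.Matrix"
begin

section \<open>The base ring\<close>

definition ring_endo :: "('a::ring_1 \<Rightarrow> 'a) \<Rightarrow> bool" where
  "ring_endo \<sigma> \<longleftrightarrow>
     (\<forall>a b. \<sigma> (a + b) = \<sigma> a + \<sigma> b) \<and> (\<forall>a b. \<sigma> (a * b) = \<sigma> a * \<sigma> b) \<and> \<sigma> 1 = 1"

text \<open>Isomorphic left modules \<open>A\<^sup>m\<close> and \<open>A\<^sup>n\<close> have \<open>m = n\<close>.\<close>

definition invariant_basis_number :: "'a::ring_1 itself \<Rightarrow> bool" where
  "invariant_basis_number (_ :: 'a itself) \<longleftrightarrow>
     (\<forall>m n. (\<exists>h. bij_betw h (carrier_vec m :: 'a vec set) (carrier_vec n :: 'a vec set) \<and>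
                 (\<forall>u\<in>carrier_vec m. \<forall>v\<in>carrier_vec m. h (u + v) = h u + h v) \<and>
                 (\<forall>a. \<forall>v\<in>carrier_vec m. h (a \<cdot>\<^sub>v v) = a \<cdot>\<^sub>v h v))
            \<longrightarrow> m = n)"


section \<open>Skew polynomials\<close>

text \<open>
  The elements of \<open>A[X;\<sigma>]\<close> are represented by the type \<^typ>\<open>'a poly\<close>, of which only the
  additive structure, the coefficients and the degree are used.  The rule \<open>X a = \<sigma>(a) X\<close>
  gives \<open>(a X\<^sup>i) (b X\<^sup>j) = a \<sigma>\<^sup>i(b) X\<^bsup>i+j\<^esup>\<close>.
\<close>

definition skew_mult :: "('a::ring_1 \<Rightarrow> 'a) \<Rightarrow> 'a poly \<Rightarrow> 'a poly \<Rightarrow> 'a poly" where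
  "skew_mult \<sigma> p q =
     (\<Sum>i\<le>degree p. \<Sum>j\<le>degree q. monom (coeff p i * (\<sigma> ^^ i) (coeff q j)) (i + j))"

lemma ring_endo_0: "ring_endo \<sigma> \<Longrightarrow> \<sigma> 0 = 0"
  unfolding ring_endo_def by (metis add_cancel_right_right)

lemma ring_endo_funpow: "ring_endo \<sigma> \<Longrightarrow> ring_endo (\<sigma> ^^ i)"
  by (induction i) (auto simp: ring_endo_def)

lemma skew_mult_bounds:
  assumes "ring_endo \<sigma>" "degree p \<le> m" "degree q \<le> n"
  shows "skew_mult \<sigma> p q =
    (\<Sum>i\<le>m. \<Sum>j\<le>n. monom (coeff p i * (\<sigma> ^^ i) (coeff q j)) (i + j))"
proof -
  have z: "(\<sigma> ^^ i) 0 = 0" for i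
    using assms(1) ring_endo_funpow ring_endo_0 by blast
  have "skew_mult \<sigma> p q =
    (\<Sum>i\<le>degree p. \<Sum>j\<le>n. monom (coeff p i * (\<sigma> ^^ i) (coeff q j)) (i + j))"
    unfolding skew_mult_def using assms(3)
    by (intro sum.cong refl sum.mono_neutral_left) (auto simp: coeff_eq_0 z)
  also have "\<dots> = (\<Sum>i\<le>m. \<Sum>j\<le>n. monom (coeff p i * (\<sigma> ^^ i) (coeff q j)) (i + j))"
    using assms(2) by (intro sum.mono_neutral_left) (auto simp: coeff_eq_0)
  finally show ?thesis .
qed

lemma skew_mult_add_left:
  assumes "ring_endo \<sigma>"
  shows "skew_mult \<sigma> (p + p') q = skew_mult \<sigma> p q + skew_mult \<sigma> p' q"
proof -
  let ?m = "max (degree p) (degree p')"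
  show ?thesis
    by (simp add: skew_mult_bounds[OF assms, where m = ?m and n = "degree q"] degree_add_le_max
        distrib_right add_monom[symmetric] sum.distrib)
qed

lemma skew_mult_add_right:
  assumes "ring_endo \<sigma>"
  shows "skew_mult \<sigma> p (q + q') = skew_mult \<sigma> p q + skew_mult \<sigma> p q'"
proof -
  let ?n = "max (degree q) (degree q')"
  have "(\<sigma> ^^ i) (a + b) = (\<sigma> ^^ i) a + (\<sigma> ^^ i) b" for i a b
    using ring_endo_funpow[OF assms] by (simp add: ring_endo_def)
  then show ?thesis
    by (simp add: skew_mult_bounds[OF assms, where m = "degree p" and n = ?n] degree_add_le_max
        distrib_left add_monom[symmetric] sum.distrib)
qed

lemma skew_mult_0 [simp]:
  assumes "ring_endo \<sigma>"
  shows "skew_mult \<sigma> 0 q = 0" "skew_mult \<sigma> p 0 = 0"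
  using skew_mult_add_left[OF assms, of 0 0 q] skew_mult_add_right[OF assms, of p 0 0] by auto

lemma skew_mult_sum_left:
  "ring_endo \<sigma> \<Longrightarrow> skew_mult \<sigma> (\<Sum>i\<in>I. P i) q = (\<Sum>i\<in>I. skew_mult \<sigma> (P i) q)"
  by (induction I rule: infinite_finite_induct) (auto simp: skew_mult_add_left)

lemma skew_mult_sum_right:
  "ring_endo \<sigma> \<Longrightarrow> skew_mult \<sigma> p (\<Sum>i\<in>I. Q i) = (\<Sum>i\<in>I. skew_mult \<sigma> p (Q i))"
  by (induction I rule: infinite_finite_induct) (auto simp: skew_mult_add_right)

lemma skew_mult_monom:
  assumes "ring_endo \<sigma>"
  shows "skew_mult \<sigma> (monom a i) (monom b j) = monom (a * (\<sigma> ^^ i) b) (i + j)"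
proof -
  have z: "(\<sigma> ^^ k) 0 = 0" for k
    using assms ring_endo_funpow ring_endo_0 by blast
  have "skew_mult \<sigma> (monom a i) (monom b j) =
    (\<Sum>k\<le>i. \<Sum>l\<le>j. if l = j then (if k = i then monom (a * (\<sigma> ^^ i) b) (i + j) else 0) else 0)"
    unfolding skew_mult_bounds[OF assms degree_monom_le degree_monom_le]
    by (intro sum.cong refl) (auto simp: z)
  also have "\<dots> = monom (a * (\<sigma> ^^ i) b) (i + j)"
    by simp
  finally show ?thesis .
qed

lemma skew_mult_assoc:
  assumes "ring_endo \<sigma>"
  shows "skew_mult \<sigma> (skew_mult \<sigma> p q) s = skew_mult \<sigma> p (skew_mult \<sigma> q s)"
proof -
  have m: "(\<sigma> ^^ i) (x * y) = (\<sigma> ^^ i) x * (\<sigma> ^^ i) y" for i x y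
    using ring_endo_funpow[OF assms] by (simp add: ring_endo_def)
  have mono: "skew_mult \<sigma> (skew_mult \<sigma> (monom a i) (monom b j)) (monom c k) =
      skew_mult \<sigma> (monom a i) (skew_mult \<sigma> (monom b j) (monom c k))" for a b c i j k
    by (simp add: skew_mult_monom[OF assms] m funpow_add mult.assoc add.assoc)
  have "skew_mult \<sigma> (skew_mult \<sigma> (\<Sum>i\<le>degree p. monom (coeff p i) i)
          (\<Sum>j\<le>degree q. monom (coeff q j) j)) (\<Sum>k\<le>degree s. monom (coeff s k) k) =
        skew_mult \<sigma> (\<Sum>i\<le>degree p. monom (coeff p i) i)
          (skew_mult \<sigma> (\<Sum>j\<le>degree q. monom (coeff q j) j) (\<Sum>k\<le>degree s. monom (coeff s k) k))"
    by (simp only: skew_mult_sum_left[OF assms] skew_mult_sum_right[OF assms] mono)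
  then show ?thesis
    by (simp only: poly_as_sum_of_monoms)
qed

lemma skew_mult_one:
  assumes "ring_endo \<sigma>"
  shows "skew_mult \<sigma> (monom 1 0) p = p" "skew_mult \<sigma> p (monom 1 0) = p"
proof -
  have o: "(\<sigma> ^^ i) 1 = 1" for i
    using ring_endo_funpow[OF assms] by (simp add: ring_endo_def)
  have "skew_mult \<sigma> (monom 1 0) (\<Sum>i\<le>degree p. monom (coeff p i) i) =
      (\<Sum>i\<le>degree p. monom (coeff p i) i)"
    by (simp only: skew_mult_sum_right[OF assms] skew_mult_monom[OF assms]) simp
  then show "skew_mult \<sigma> (monom 1 0) p = p"
    by (simp only: poly_as_sum_of_monoms)
  have "skew_mult \<sigma> (\<Sum>i\<le>degree p. monom (coeff p i) i) (monom 1 0) =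
      (\<Sum>i\<le>degree p. monom (coeff p i) i)"
    by (simp only: skew_mult_sum_left[OF assms] skew_mult_monom[OF assms]) (simp add: o)
  then show "skew_mult \<sigma> p (monom 1 0) = p"
    by (simp only: poly_as_sum_of_monoms)
qed

lemma skew_mult_X_const:
  "ring_endo \<sigma> \<Longrightarrow>
   skew_mult \<sigma> (monom 1 1) (monom a 0) = skew_mult \<sigma> (monom (\<sigma> a) 0) (monom 1 1)"
  by (simp add: skew_mult_monom)

definition left_ideal :: "('a::ring_1 \<Rightarrow> 'a) \<Rightarrow> 'a poly \<Rightarrow> 'a poly set" where
  "left_ideal \<sigma> p = range (\<lambda>h. skew_mult \<sigma> h p)"

definition right_divisor :: "('a::ring_1 \<Rightarrow> 'a) \<Rightarrow> 'a poly \<Rightarrow> 'a poly \<Rightarrow> bool" where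
  "right_divisor \<sigma> g f \<longleftrightarrow> (\<exists>h. f = skew_mult \<sigma> h g)"


section \<open>The left module \<open>A[X;\<sigma>]/(f)\<^sub>l\<close>\<close>

definition residue_class :: "('a::ring_1 \<Rightarrow> 'a) \<Rightarrow> 'a poly \<Rightarrow> 'a poly \<Rightarrow> 'a poly set" where
  "residue_class \<sigma> f p = (\<lambda>h. p + h) ` left_ideal \<sigma> f"

definition quotient_module :: "('a::ring_1 \<Rightarrow> 'a) \<Rightarrow> 'a poly \<Rightarrow> 'a poly set set" where
  "quotient_module \<sigma> f = range (residue_class \<sigma> f)"

definition class_add :: "'a::ring_1 poly set \<Rightarrow> 'a poly set \<Rightarrow> 'a poly set" where
  "class_add U V = {u + v | u v. u \<in> U \<and> v \<in> V}"

definition class_smult ::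
  "('a::ring_1 \<Rightarrow> 'a) \<Rightarrow> 'a poly \<Rightarrow> 'a poly \<Rightarrow> 'a poly set \<Rightarrow> 'a poly set" where
  "class_smult \<sigma> f p U = {skew_mult \<sigma> p u + h | u h. u \<in> U \<and> h \<in> left_ideal \<sigma> f}"

lemma left_ideal_closed:
  assumes "ring_endo \<sigma>"
  shows "0 \<in> left_ideal \<sigma> f"
    and "h \<in> left_ideal \<sigma> f \<Longrightarrow> k \<in> left_ideal \<sigma> f \<Longrightarrow> h + k \<in> left_ideal \<sigma> f"
    and "h \<in> left_ideal \<sigma> f \<Longrightarrow> skew_mult \<sigma> p h \<in> left_ideal \<sigma> f"
  unfolding left_ideal_def image_iff
  using skew_mult_0(1)[OF assms] skew_mult_add_left[OF assms] skew_mult_assoc[OF assms]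
  by (metis UNIV_I)+

lemma class_add_residue_class:
  assumes "ring_endo \<sigma>"
  shows "class_add (residue_class \<sigma> f p) (residue_class \<sigma> f q) = residue_class \<sigma> f (p + q)"
proof (intro Set.set_eqI iffI)
  fix x assume "x \<in> class_add (residue_class \<sigma> f p) (residue_class \<sigma> f q)"
  then obtain h k where "h \<in> left_ideal \<sigma> f" "k \<in> left_ideal \<sigma> f" "x = (p + h) + (q + k)"
    unfolding class_add_def residue_class_def by blast
  then have "x = (p + q) + (h + k)" "h + k \<in> left_ideal \<sigma> f"
    using left_ideal_closed[OF assms] by (auto simp: algebra_simps)
  then show "x \<in> residue_class \<sigma> f (p + q)"
    unfolding residue_class_def by blast
next
  fix x assume "x \<in> residue_class \<sigma> f (p + q)"
  then obtain h where h: "h \<in> left_ideal \<sigma> f" "x = (p + 0) + (q + h)"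
    unfolding residue_class_def by (auto simp: algebra_simps)
  then show "x \<in> class_add (residue_class \<sigma> f p) (residue_class \<sigma> f q)"
    unfolding class_add_def residue_class_def using left_ideal_closed(1)[OF assms] by blast
qed

lemma class_smult_residue_class:
  assumes "ring_endo \<sigma>"
  shows "class_smult \<sigma> f p (residue_class \<sigma> f q) = residue_class \<sigma> f (skew_mult \<sigma> p q)"
proof (intro Set.set_eqI iffI)
  fix x assume "x \<in> class_smult \<sigma> f p (residue_class \<sigma> f q)"
  then obtain h k where hk: "h \<in> left_ideal \<sigma> f" "k \<in> left_ideal \<sigma> f"
      "x = skew_mult \<sigma> p (q + h) + k"
    unfolding class_smult_def residue_class_def by blast
  then have "x = skew_mult \<sigma> p q + (skew_mult \<sigma> p h + k)"
    by (simp add: skew_mult_add_right[OF assms] add.assoc)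
  moreover have "skew_mult \<sigma> p h + k \<in> left_ideal \<sigma> f"
    using hk left_ideal_closed[OF assms] by blast
  ultimately show "x \<in> residue_class \<sigma> f (skew_mult \<sigma> p q)"
    unfolding residue_class_def by blast
next
  fix x assume "x \<in> residue_class \<sigma> f (skew_mult \<sigma> p q)"
  then obtain h where "h \<in> left_ideal \<sigma> f" "x = skew_mult \<sigma> p (q + 0) + h"
    unfolding residue_class_def by auto
  then show "x \<in> class_smult \<sigma> f p (residue_class \<sigma> f q)"
    unfolding class_smult_def residue_class_def using left_ideal_closed(1)[OF assms] by blast
qed

definition left_submodule :: "('a::ring_1 \<Rightarrow> 'a) \<Rightarrow> 'a poly \<Rightarrow> 'a poly set set \<Rightarrow> bool" where
  "left_submodule \<sigma> f M \<longleftrightarrow>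
     M \<subseteq> quotient_module \<sigma> f \<and> residue_class \<sigma> f 0 \<in> M \<and>
     (\<forall>U\<in>M. \<forall>V\<in>M. class_add U V \<in> M) \<and>
     (\<forall>p. \<forall>U\<in>M. class_smult \<sigma> f p U \<in> M)"


section \<open>Codes\<close>

definition phi :: "('a::ring_1 \<Rightarrow> 'a) \<Rightarrow> 'a poly \<Rightarrow> 'a vec \<Rightarrow> 'a poly set" where
  "phi \<sigma> f d = residue_class \<sigma> f (\<Sum>i<degree f. monom (d $ i) i)"

definition code_of :: "('a::ring_1 \<Rightarrow> 'a) \<Rightarrow> 'a poly \<Rightarrow> 'a poly set set \<Rightarrow> 'a vec set" where
  "code_of \<sigma> f M = {d \<in> carrier_vec (degree f). phi \<sigma> f d \<in> M}"

definition skew_code :: "('a::ring_1 \<Rightarrow> 'a) \<Rightarrow> 'a poly \<Rightarrow> 'a vec set \<Rightarrow> bool" where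
  "skew_code \<sigma> f C \<longleftrightarrow> (\<exists>M. left_submodule \<sigma> f M \<and> C = code_of \<sigma> f M)"

text \<open>The set \<open>residue_class \<sigma> f ` left_ideal \<sigma> g\<close> is \<open>(g)\<^sub>l/(f)\<^sub>l\<close>.\<close>

definition principal_skew_code ::
  "('a::ring_1 \<Rightarrow> 'a) \<Rightarrow> 'a poly \<Rightarrow> 'a poly \<Rightarrow> 'a vec set \<Rightarrow> bool" where
  "principal_skew_code \<sigma> f g C \<longleftrightarrow>
     skew_code \<sigma> f C \<and> right_divisor \<sigma> g f \<and>
     C = code_of \<sigma> f (residue_class \<sigma> f ` left_ideal \<sigma> g)"


section \<open>Generating matrices\<close>

definition left_lincomb :: "nat \<Rightarrow> 'a::ring_1 vec list \<Rightarrow> 'a vec \<Rightarrow> 'a vec" where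
  "left_lincomb n vs c = vec n (\<lambda>j. \<Sum>i<length vs. c $ i * vs ! i $ j)"

text \<open>A basis is taken as an indexed family, so that repeated vectors are dependent.\<close>

definition left_basis :: "nat \<Rightarrow> 'a::ring_1 vec list \<Rightarrow> 'a vec set \<Rightarrow> bool" where
  "left_basis n vs C \<longleftrightarrow>
     C = left_lincomb n vs ` carrier_vec (length vs) \<and>
     (\<forall>c\<in>carrier_vec (length vs). left_lincomb n vs c = 0\<^sub>v n \<longrightarrow> c = 0\<^sub>v (length vs))"

definition generating_matrix ::
  "nat \<Rightarrow> nat \<Rightarrow> 'a::ring_1 vec set \<Rightarrow> 'a mat \<Rightarrow> bool" where
  "generating_matrix m n C G \<longleftrightarrow> G \<in> carrier_mat m n \<and> left_basis n (rows G) C"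

end

theory Submission
  imports Defs
begin

text \<open>
  Identify a word \<open>d \<in> A\<^sup>n\<close> with the polynomial \<open>\<Sum>i<n. d\<^sub>i X\<^sup>i\<close>.  As \<open>g\<close> divides \<open>f\<close> on the
  right, \<open>(f)\<^sub>l \<subseteq> (g)\<^sub>l\<close>, so membership in \<open>(g)\<^sub>l/(f)\<^sub>l\<close> does not depend on the representative, and
  the principal code generated by \<open>g\<close> consists of the words whose polynomial is a left multiple
  \<open>q g\<close> (lemma \<open>principal_skew_code_iff\<close>).

  Row \<open>i\<close> of the matrix is the word of \<open>X\<^sup>i g = \<Sum>\<^sub>l \<sigma>\<^sup>i(g\<^sub>l) X\<^bsup>i+l\<^esup>\<close>, so the left combination of the
  rows with coefficients \<open>c\<close> is the word of \<open>(\<Sum>i<n-r. c\<^sub>i X\<^sup>i) g\<close> (lemma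
  \<open>word_poly_left_lincomb_rows\<close>).  Everything then rests on one consequence of \<open>g\<close> being monic:
  since \<open>\<sigma>\<^sup>i(1) = 1\<close>, the coefficient of \<open>q g\<close> in degree \<open>deg q + r\<close> is the leading coefficient of
  \<open>q\<close> (lemma \<open>coeff_skew_mult_monic_top\<close>), even if \<open>A\<close> has zero divisors and \<open>\<sigma>\<close> is not injective.
  Hence \<open>q g = 0\<close> forces \<open>q = 0\<close>, which gives independence of the rows, and \<open>deg (q g) < n\<close>
  forces \<open>deg q < n - r\<close>, which shows that the rows span the code.
\<close>

definition word_poly :: "nat \<Rightarrow> 'a::ring_1 vec \<Rightarrow> 'a poly" where
  "word_poly n d = (\<Sum>i<n. monom (d $ i) i)"

lemma coeff_word_poly: "coeff (word_poly n d) j = (if j < n then d $ j else 0)"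
  by (simp add: word_poly_def coeff_sum)

lemma word_poly_inject:
  assumes "d \<in> carrier_vec n" "e \<in> carrier_vec n" "word_poly n d = word_poly n e"
  shows "d = e"
proof (rule eq_vecI)
  fix i assume "i < dim_vec e"
  then have "i < n" using assms(2) by simp
  then show "d $ i = e $ i"
    using arg_cong[OF assms(3), of "\<lambda>p. coeff p i"] by (simp add: coeff_word_poly)
qed (use assms in simp)

lemma word_poly_vec_coeff:
  assumes "\<And>i. m \<le> i \<Longrightarrow> coeff q i = 0"
  shows "word_poly m (vec m (coeff q)) = q"
  using assms by (intro poly_eqI) (simp add: coeff_word_poly)

lemma coeff_monom_skew_mult:
  assumes "ring_endo \<sigma>"
  shows "coeff (skew_mult \<sigma> (monom a i) g) k =
    a * (if i \<le> k \<and> k \<le> i + degree g then (\<sigma> ^^ i) (coeff g (k - i)) else 0)"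
proof -
  have "skew_mult \<sigma> (monom a i) (\<Sum>l\<le>degree g. monom (coeff g l) l) =
      (\<Sum>l\<le>degree g. monom (a * (\<sigma> ^^ i) (coeff g l)) (i + l))"
    by (simp only: skew_mult_sum_right[OF assms] skew_mult_monom[OF assms])
  then have "coeff (skew_mult \<sigma> (monom a i) g) k =
      (\<Sum>l\<le>degree g. if i + l = k then a * (\<sigma> ^^ i) (coeff g l) else 0)"
    by (simp add: poly_as_sum_of_monoms coeff_sum)
  also have "\<dots> = (\<Sum>l\<le>degree g. if l = k - i
      then (if i \<le> k then a * (\<sigma> ^^ i) (coeff g l) else 0) else 0)"
    by (intro sum.cong) auto
  also have "\<dots> = a * (if i \<le> k \<and> k \<le> i + degree g then (\<sigma> ^^ i) (coeff g (k - i)) else 0)"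
    by auto
  finally show ?thesis .
qed

lemma coeff_word_poly_skew_mult:
  assumes "ring_endo \<sigma>"
  shows "coeff (skew_mult \<sigma> (word_poly m c) g) k =
    (\<Sum>i<m. c $ i * (if i \<le> k \<and> k \<le> i + degree g then (\<sigma> ^^ i) (coeff g (k - i)) else 0))"
  by (simp add: word_poly_def skew_mult_sum_left[OF assms] coeff_sum
      coeff_monom_skew_mult[OF assms] del: mult_zero_right)

text \<open>
  Only the top terms of \<open>q\<close> and \<open>g\<close> reach degree \<open>deg q + deg g\<close>, and they contribute
  \<open>q\<^sub>s \<sigma>\<^sup>s(1) = q\<^sub>s\<close> with \<open>s = deg q\<close>.  This stands in for cancellation, which fails in a ring
  \<open>A\<close> with zero divisors.
\<close>
lemma coeff_skew_mult_monic_top: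
  assumes "ring_endo \<sigma>" "lead_coeff g = 1"
  shows "coeff (skew_mult \<sigma> q g) (degree q + degree g) = lead_coeff q"
proof -
  let ?s = "degree q"
  have one: "(\<sigma> ^^ ?s) 1 = 1"
    using ring_endo_funpow[OF assms(1)] by (simp add: ring_endo_def)
  have "word_poly (Suc ?s) (vec (Suc ?s) (coeff q)) = q"
    by (intro word_poly_vec_coeff) (simp add: coeff_eq_0)
  then have "coeff (skew_mult \<sigma> q g) (?s + degree g) =
      (\<Sum>i<Suc ?s. coeff q i * (if i \<le> ?s + degree g \<and> ?s + degree g \<le> i + degree g
         then (\<sigma> ^^ i) (coeff g (?s + degree g - i)) else 0))"
    using coeff_word_poly_skew_mult[OF assms(1), of "Suc ?s" "vec (Suc ?s) (coeff q)" g]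
    by (simp del: sum.lessThan_Suc)
  also have "\<dots> = (\<Sum>i<Suc ?s. if i = ?s then lead_coeff q else 0)"
    by (intro sum.cong) (auto simp: one assms(2))
  finally show ?thesis by simp
qed

lemma skew_mult_monic_eq_0:
  assumes "ring_endo \<sigma>" "lead_coeff g = 1" "skew_mult \<sigma> q g = 0"
  shows "q = 0"
  using coeff_skew_mult_monic_top[OF assms(1,2), of q] assms(3) by simp

text \<open>
  The degree of \<open>q g\<close> is at least \<open>deg q + deg g\<close> for \<open>q \<noteq> 0\<close>.  The strict bounds
  \<open>deg (q g) < n\<close> and \<open>deg q < n - deg g\<close> are expressed by vanishing coefficients because the
  degree 0 assigned to the zero polynomial would violate the second one when \<open>n \<le> deg g\<close>.
\<close>
lemma skew_mult_monic_degree_bound: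
  assumes "ring_endo \<sigma>" "lead_coeff g = 1"
    and "\<And>k. n \<le> k \<Longrightarrow> coeff (skew_mult \<sigma> q g) k = 0" and "n - degree g \<le> i"
  shows "coeff q i = 0"
proof (rule ccontr)
  assume nz: "coeff q i \<noteq> 0"
  then have "i \<le> degree q" by (rule le_degree)
  then have "n \<le> degree q + degree g" using assms(4) by simp
  then have "lead_coeff q = 0"
    using coeff_skew_mult_monic_top[OF assms(1,2)] assms(3) by metis
  then show False using nz by simp
qed

lemma left_ideal_subset_of_right_divisor:
  assumes "ring_endo \<sigma>" "right_divisor \<sigma> g f"
  shows "left_ideal \<sigma> f \<subseteq> left_ideal \<sigma> g"
  using assms by (auto simp: left_ideal_def right_divisor_def skew_mult_assoc[symmetric])

lemma residue_class_mem_image_left_ideal_iff: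
  assumes "ring_endo \<sigma>" "right_divisor \<sigma> g f"
  shows "residue_class \<sigma> f p \<in> residue_class \<sigma> f ` left_ideal \<sigma> g \<longleftrightarrow> p \<in> left_ideal \<sigma> g"
proof
  assume "residue_class \<sigma> f p \<in> residue_class \<sigma> f ` left_ideal \<sigma> g"
  then obtain q where q: "q \<in> left_ideal \<sigma> g" "residue_class \<sigma> f p = residue_class \<sigma> f q"
    by blast
  have "p \<in> residue_class \<sigma> f p"
    unfolding residue_class_def using left_ideal_closed(1)[OF assms(1)] by force
  then obtain h where "h \<in> left_ideal \<sigma> f" "p = q + h"
    unfolding q(2) by (auto simp: residue_class_def)
  then show "p \<in> left_ideal \<sigma> g"
    using q(1) left_ideal_closed(2)[OF assms(1)] left_ideal_subset_of_right_divisor[OF assms]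
    by blast
qed simp

lemma principal_skew_code_iff:
  assumes "ring_endo \<sigma>" "principal_skew_code \<sigma> f g C"
  shows "d \<in> C \<longleftrightarrow> d \<in> carrier_vec (degree f) \<and> word_poly (degree f) d \<in> left_ideal \<sigma> g"
  using assms residue_class_mem_image_left_ideal_iff[OF assms(1)]
  by (simp add: principal_skew_code_def code_of_def phi_def word_poly_def)

definition skew_shift_matrix ::
  "('a::ring_1 \<Rightarrow> 'a) \<Rightarrow> 'a poly \<Rightarrow> nat \<Rightarrow> 'a mat" where
  "skew_shift_matrix \<sigma> g n = mat (n - degree g) n
     (\<lambda>(i, j). if i \<le> j \<and> j \<le> i + degree g then (\<sigma> ^^ i) (coeff g (j - i)) else 0)"

text \<open>
  Taking combinations of the rows is right multiplication by \<open>g\<close>.  No coefficient is lost by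
  cutting off at \<open>n\<close>: if there are any rows, the last has index \<open>n - deg g - 1\<close> and so ends in
  column \<open>n - 1\<close>.
\<close>
lemma word_poly_left_lincomb_rows:
  assumes "ring_endo \<sigma>"
  shows "word_poly n (left_lincomb n (rows (skew_shift_matrix \<sigma> g n)) c) =
    skew_mult \<sigma> (word_poly (n - degree g) c) g"
proof (rule poly_eqI)
  fix k
  show "coeff (word_poly n (left_lincomb n (rows (skew_shift_matrix \<sigma> g n)) c)) k =
    coeff (skew_mult \<sigma> (word_poly (n - degree g) c) g) k"
  proof (cases "k < n")
    case True
    then show ?thesis
      by (auto simp: coeff_word_poly coeff_word_poly_skew_mult[OF assms] left_lincomb_def
          skew_shift_matrix_def intro!: sum.cong)
  next
    case False
    then show ?thesis
      by (auto simp: coeff_word_poly coeff_word_poly_skew_mult[OF assms]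
          intro!: sum.neutral)
  qed
qed

theorem corollary3p8:
  fixes \<sigma> :: "'a::ring_1 \<Rightarrow> 'a" and f g :: "'a poly" and C :: "'a vec set" and n r :: nat
  assumes "invariant_basis_number TYPE('a)"
    and "ring_endo \<sigma>"
    and "lead_coeff f = 1" and "degree f = n"
    and "lead_coeff g = 1" and "degree g = r"
    and "principal_skew_code \<sigma> f g C"
  shows "generating_matrix (n - r) n C
           (mat (n - r) n (\<lambda>(i, j). if i \<le> j \<and> j \<le> i + r then (\<sigma> ^^ i) (coeff g (j - i)) else 0))"
proof -
  note endo = \<open>ring_endo \<sigma>\<close> and monic = \<open>lead_coeff g = 1\<close>
  let ?G = "skew_shift_matrix \<sigma> g n"
  let ?m = "n - r"
  let ?L = "left_lincomb n (rows ?G)"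
  have G: "?G \<in> carrier_mat ?m n" and len: "length (rows ?G) = ?m"
    using assms(6) by (simp_all add: skew_shift_matrix_def)
  have L_carrier: "?L c \<in> carrier_vec n" for c
    by (simp add: left_lincomb_def)
  have L_poly: "word_poly n (?L c) = skew_mult \<sigma> (word_poly ?m c) g" for c
    using word_poly_left_lincomb_rows[OF endo] assms(6) by blast
  have C_iff: "d \<in> C \<longleftrightarrow> d \<in> carrier_vec n \<and> word_poly n d \<in> left_ideal \<sigma> g" for d
    using principal_skew_code_iff[OF endo assms(7)] assms(4) by simp
  have "?L ` carrier_vec ?m = C"
  proof (intro subset_antisym subsetI)
    fix d assume "d \<in> ?L ` carrier_vec ?m"
    then show "d \<in> C"
      using L_carrier L_poly by (auto simp: C_iff left_ideal_def)
  next
    fix d assume "d \<in> C"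
    then obtain q where d: "d \<in> carrier_vec n" and q: "word_poly n d = skew_mult \<sigma> q g"
      by (auto simp: C_iff left_ideal_def)
    have "coeff (skew_mult \<sigma> q g) k = 0" if "n \<le> k" for k
      using that by (simp add: q[symmetric] coeff_word_poly)
    then have "coeff q i = 0" if "?m \<le> i" for i
      using skew_mult_monic_degree_bound[OF endo monic] that assms(6) by blast
    then have "word_poly n d = word_poly n (?L (vec ?m (coeff q)))"
      by (simp add: L_poly q word_poly_vec_coeff)
    then have "d = ?L (vec ?m (coeff q))"
      by (rule word_poly_inject[OF d L_carrier])
    then show "d \<in> ?L ` carrier_vec ?m" by simp
  qed
  moreover have "c = 0\<^sub>v ?m" if c: "c \<in> carrier_vec ?m" and "?L c = 0\<^sub>v n" for c
  proof -
    have zero: "word_poly k (0\<^sub>v k) = (0 :: 'a poly)" for k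
      by (intro poly_eqI) (simp add: coeff_word_poly)
    have "skew_mult \<sigma> (word_poly ?m c) g = 0"
      using L_poly[of c] that(2) zero by simp
    then have "word_poly ?m c = word_poly ?m (0\<^sub>v ?m)"
      using skew_mult_monic_eq_0[OF endo monic] zero by simp
    then show ?thesis by (rule word_poly_inject[OF c zero_carrier_vec])
  qed
  ultimately have "generating_matrix ?m n C ?G"
    using G unfolding generating_matrix_def left_basis_def len by blast
  then show ?thesis
    using assms(6) by (simp add: skew_shift_matrix_def)
qed

end
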